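(* Let $\gamma>0$ and let $u(c)=\frac{c^{1-\gamma}}{1-\gamma}$ if $\gamma\neq1$, $u(c)=\ln c$ if $\gamma=1$. Suppose that $t\mapsto\lambda(t)$ is a non-negative function on $[0,\infty)$ solving the fixed-point problem $$\lambda(t)=\left[\int_t^\infty\lambda(s)^{1-\gamma}\exp\Bigl[-(1-\gamma)\int_t^s(\lambda(v)-r(v))\,dv\Bigr]h(s-t)\,ds\right]^{-\frac1\gamma}\qquad(t\ge0).$$ Then the strategy $$\sigma(t,k)=\lambda(t)\left[k+\int_t^\infty\exp\Bigl[-\int_t^s r(v)\,dv\Bigr]w(s)\,ds\right]$$ is an equilibrium strategy for the infinite-horizon consumption-saving problem. For $\gamma\ne1$ the associated value function is $$V(t,k)=[\lambda(t)]^{-\gamma}\,\frac{\left[k+\int_t^\infty\exp\bigl[-\int_t^s r(v)\,dv\bigr]w(s)\,ds\right]^{1-\gamma}}{1-\gamma}.$$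
   Context: The discount function $h:[0,\infty)\to\mathbb{R}$ is continuously differentiable with $h(0)=1$, $h\ge0$, $h'\le0$, $h(t)\to0$ as $t\to\infty$. Here $d=1$, and $r(t)$ (interest rate) and $w(t)$ (wage) are given functions of $t\in[0,\infty)$ for which all the integrals written are well defined. Infinite-horizon consumption-saving problem: the decision-maker at time $t$ with capital $k_t$ wants to maximise $\int_t^\infty h(s-t)u(c(s))\,ds$ subject to $\frac{dk}{ds}=w(s)+r(s)k(s)-c(s)$, $k(t)=k_t$. Capital levels $k$ at time $t$ are those for which total wealth $k+\int_t^\infty\exp[-\int_t^s r(v)dv]\,w(s)\,ds$ is positive (in particular all $k>0$ when wages are non-negative). Let $i$ be the inverse function of $u'$, so $i(x)=x^{-1/\gamma}$. A strategy $\sigma$ is an equilibrium strategy for this infinite-horizon problem, with associated value function $V$, if $\sigma(t,k)=i\bigl(\frac{\partial V}{\partial k}(t,k)\bigr)$ where $V$ satisfies the integrated equilibrium equation $$V(t,k)=\int_t^\infty h(s-t)\,u\Bigl(i\bigl(\tfrac{\partial V}{\partial k}(s,\mathcal{K}(s,t,k))\bigr)\Bigr)ds$$ and the flow $\mathcal{K}$ solves $\frac{\partial\mathcal{K}(s,t,k)}{\partial s}=w(s)+r(s)\mathcal{K}(s,t,k)-i\bigl(\frac{\partial V}{\partial k}(s,\mathcal{K}(s,t,k))\bigr)$, $\mathcal{K}(t,t,k)=k$.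
   Formalization: For γ=1 the utility integral along the strategy is assumed to converge (it diverges e.g. for h(s)=(1+s)^(-3/2), r=w=0); the bracket is assumed finite and positive; the flow equation is read in integrated form, pointwise where its right side is continuous along the flow. *)

theory Defs
  imports "HOL-Analysis.Analysis"
begin

text \<open>
  Conventions. Integrals over unbounded intervals are Henstock--Kurzweil integrals; these extend the
  Lebesgue integral and also cover conditionally convergent improper integrals. On compact intervals
  integrability is absolute (Lebesgue) integrability. All functions of time live on \<open>{0..}\<close>; their
  values at negative times are never used.
\<close>

definition discount_function :: "(real \<Rightarrow> real) \<Rightarrow> bool" where
  "discount_function h \<longleftrightarrow>
     (\<exists>h'. (\<forall>t\<ge>0. (h has_real_derivative h' t) (at t within {0..}) \<and> h' t \<le> 0) \<and>
           continuous_on {0..} h') \<and>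
     h 0 = 1 \<and> (\<forall>t\<ge>0. 0 \<le> h t) \<and> (h \<longlongrightarrow> 0) at_top"

definition crra :: "real \<Rightarrow> real \<Rightarrow> real" where
  "crra \<gamma> c = (if \<gamma> = 1 then ln c else c powr (1 - \<gamma>) / (1 - \<gamma>))"

definition inverse_marginal :: "(real \<Rightarrow> real) \<Rightarrow> real \<Rightarrow> real" where
  "inverse_marginal u = the_inv_into {0<..} (deriv u)"

lemma deriv_crra: "deriv (crra \<gamma>) c = c powr (- \<gamma>)" if "0 < c"
proof (cases "\<gamma> = 1")
  case True
  have "((\<lambda>c. ln c) has_real_derivative c powr (- \<gamma>)) (at c)"
    using that True by (auto intro!: derivative_eq_intros simp: powr_minus divide_simps)
  moreover have "crra \<gamma> = (\<lambda>c. ln c)"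
    using True by (auto simp: crra_def)
  ultimately show ?thesis
    by (simp add: DERIV_imp_deriv)
next
  case False
  have "((\<lambda>c. c powr (1 - \<gamma>) / (1 - \<gamma>)) has_real_derivative c powr (- \<gamma>)) (at c)"
    using that False by (auto intro!: derivative_eq_intros)
  moreover have "crra \<gamma> = (\<lambda>c. c powr (1 - \<gamma>) / (1 - \<gamma>))"
    using False by (auto simp: crra_def)
  ultimately show ?thesis
    by (simp add: DERIV_imp_deriv)
qed

lemma inverse_marginal_crra: "inverse_marginal (crra \<gamma>) x = x powr (- 1 / \<gamma>)"
  if "0 < \<gamma>" "0 < x"
proof -
  have inj: "inj_on (deriv (crra \<gamma>)) {0<..}"
  proof (rule inj_onI)
    fix c d :: real
    assume "c \<in> {0<..}" "d \<in> {0<..}" "deriv (crra \<gamma>) c = deriv (crra \<gamma>) d"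
    then have cd: "0 < c" "0 < d" "c powr (- \<gamma>) = d powr (- \<gamma>)"
      by (auto simp: deriv_crra)
    have "(c powr (- \<gamma>)) powr (- 1 / \<gamma>) = (d powr (- \<gamma>)) powr (- 1 / \<gamma>)"
      using cd by simp
    then show "c = d"
      using that cd(1,2) by (simp add: powr_powr)
  qed
  have "deriv (crra \<gamma>) (x powr (- 1 / \<gamma>)) = x"
    using that by (simp add: deriv_crra powr_powr)
  then show ?thesis
    unfolding inverse_marginal_def using that by (intro the_inv_into_f_eq[OF inj]) auto
qed

definition human_wealth :: "(real \<Rightarrow> real) \<Rightarrow> (real \<Rightarrow> real) \<Rightarrow> real \<Rightarrow> real" where
  "human_wealth r w t = integral {t..} (\<lambda>s. exp (- integral {t..s} r) * w s)"

definition total_wealth :: "(real \<Rightarrow> real) \<Rightarrow> (real \<Rightarrow> real) \<Rightarrow> real \<Rightarrow> real \<Rightarrow> real" where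
  "total_wealth r w t k = k + human_wealth r w t"

text \<open>
  Solutions of \<open>x' = f s x\<close> on \<open>{t..}\<close> for a right-hand side that need not be continuous in time: an
  absolutely continuous function solving the equation in integrated form, which moreover
  satisfies the differential equation pointwise wherever the right-hand side is continuous along
  the solution. If \<open>f\<close> is continuous, this is a classical solution.
\<close>
definition ode_solution_from :: "real \<Rightarrow> (real \<Rightarrow> real \<Rightarrow> real) \<Rightarrow> (real \<Rightarrow> real) \<Rightarrow> bool" where
  "ode_solution_from t f x \<longleftrightarrow>
     (\<forall>s\<ge>t. (\<lambda>v. f v (x v)) absolutely_integrable_on {t..s} \<and>
            x s = x t + integral {t..s} (\<lambda>v. f v (x v)) \<and>
            (continuous (at s within {t..}) (\<lambda>v. f v (x v)) \<longrightarrow>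
              (x has_real_derivative f s (x s)) (at s within {t..})))"

text \<open>
  \<open>K s t k\<close> is the capital at time \<open>s\<close> when the strategy \<open>\<sigma>\<close> is followed from capital \<open>k\<close> at time
  \<open>t\<close>. It must remain in the region of positive total wealth.
\<close>
definition capital_flow ::
  "(real \<Rightarrow> real) \<Rightarrow> (real \<Rightarrow> real) \<Rightarrow> (real \<Rightarrow> real \<Rightarrow> real) \<Rightarrow> (real \<Rightarrow> real \<Rightarrow> real \<Rightarrow> real) \<Rightarrow> bool"
  where
  "capital_flow r w \<sigma> K \<longleftrightarrow>
     (\<forall>t k. 0 \<le> t \<and> 0 < total_wealth r w t k \<longrightarrow>
        K t t k = k \<and>
        (\<forall>s\<ge>t. 0 < total_wealth r w s (K s t k)) \<and>
        ode_solution_from t (\<lambda>s x. w s + r s * x - \<sigma> s x) (\<lambda>s. K s t k))"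

text \<open>
  Positivity of \<open>\<partial>V/\<partial>k\<close> is required because the inverse of \<open>u'\<close> has domain \<open>{0<..}\<close>.
\<close>
definition equilibrium_strategy ::
  "(real \<Rightarrow> real) \<Rightarrow> (real \<Rightarrow> real) \<Rightarrow> (real \<Rightarrow> real) \<Rightarrow> (real \<Rightarrow> real) \<Rightarrow>
   (real \<Rightarrow> real \<Rightarrow> real) \<Rightarrow> (real \<Rightarrow> real \<Rightarrow> real) \<Rightarrow> bool"
  where
  "equilibrium_strategy h u r w \<sigma> V \<longleftrightarrow>
     (\<forall>t k. 0 \<le> t \<and> 0 < total_wealth r w t k \<longrightarrow>
        V t differentiable (at k) \<and> 0 < deriv (V t) k \<and>
        \<sigma> t k = inverse_marginal u (deriv (V t) k)) \<and>
     (\<exists>K. capital_flow r w (\<lambda>s x. inverse_marginal u (deriv (V s) x)) K \<and>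
        (\<forall>t k. 0 \<le> t \<and> 0 < total_wealth r w t k \<longrightarrow>
           ((\<lambda>s. h (s - t) * u (inverse_marginal u (deriv (V s) (K s t k))))
              has_integral V t k) {t..}))"

definition fixed_point_integrand ::
  "(real \<Rightarrow> real) \<Rightarrow> (real \<Rightarrow> real) \<Rightarrow> real \<Rightarrow> (real \<Rightarrow> real) \<Rightarrow> real \<Rightarrow> real \<Rightarrow> real" where
  "fixed_point_integrand h r \<gamma> lam t s =
     lam s powr (1 - \<gamma>) * exp (- (1 - \<gamma>) * integral {t..s} (\<lambda>v. lam v - r v)) * h (s - t)"

text \<open>
  The integral must be finite and nonzero for its negative power to be a real number. Positivity is
  stated explicitly since \<open>0 powr a = 0\<close> would otherwise admit spurious solutions such as
  \<open>lam = (\<lambda>_. 0)\<close>.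
\<close>
definition solves_fixed_point ::
  "(real \<Rightarrow> real) \<Rightarrow> (real \<Rightarrow> real) \<Rightarrow> real \<Rightarrow> (real \<Rightarrow> real) \<Rightarrow> bool" where
  "solves_fixed_point h r \<gamma> lam \<longleftrightarrow>
     (\<forall>t\<ge>0. fixed_point_integrand h r \<gamma> lam t integrable_on {t..} \<and>
            0 < integral {t..} (fixed_point_integrand h r \<gamma> lam t) \<and>
            lam t = integral {t..} (fixed_point_integrand h r \<gamma> lam t) powr (- 1 / \<gamma>))"

text \<open>
  For \<open>\<gamma> = 1\<close> the integrand of the fixed-point equation is just \<open>h (s - t)\<close>, so convergence of the
  discounted utility integral is a separate matter. Under \<open>\<sigma> s k = lam s * total_wealth r w s k\<close>
  total wealth grows at rate \<open>r - lam\<close>, so the following is the discounted logarithmic utility of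
  the consumption path that starts at time \<open>t\<close> from total wealth 1; other initial wealths \<open>x\<close> only add
  the integrable term \<open>h (s - t) * ln x\<close>. For \<open>\<gamma> \<noteq> 1\<close> the analogous condition is already contained
  in the fixed-point equation.
\<close>
definition log_utility_integrable :: "(real \<Rightarrow> real) \<Rightarrow> (real \<Rightarrow> real) \<Rightarrow> (real \<Rightarrow> real) \<Rightarrow> bool" where
  "log_utility_integrable h r lam \<longleftrightarrow>
     (\<forall>t\<ge>0. (\<lambda>s. h (s - t) * ln (lam s * exp (- integral {t..s} (\<lambda>v. lam v - r v))))
        integrable_on {t..})"

end

theory Submission
  imports Defs
begin

text \<open>
  Since the fixed-point integral is positive, \<open>lam\<close> is positive and \<open>lam t powr (- \<gamma>)\<close> equals that
  integral. Both value functions below satisfy \<open>\<partial>V/\<partial>k = (lam t * total_wealth r w t k) powr (- \<gamma>)\<close>,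
  so that the inverse marginal utility of \<open>\<partial>V/\<partial>k\<close> is the proportional strategy. Under this strategy
  total wealth obeys \<open>X' = (r - lam) X\<close>, because human wealth obeys \<open>H' = r H - w\<close>; hence
  \<open>X s = X t * exp (- \<integral> (lam - r))\<close>, and capital is \<open>X - H\<close>. Along this path the discounted utility is,
  for \<open>\<gamma> \<noteq> 1\<close>, the constant \<open>X t powr (1 - \<gamma>) / (1 - \<gamma>)\<close> times the integrand of the fixed-point equation,
  so its integral is the claimed \<open>V\<close>. For \<open>\<gamma> = 1\<close> the integrand of the fixed-point equation is the
  discount factor, and \<open>V t k\<close> is \<open>ln (X t)\<close> times its integral plus a term that does not depend on \<open>k\<close>.

  The analytic difficulty is that \<open>r\<close>, \<open>w\<close> and \<open>lam\<close> are merely locally Lebesgue integrable, so the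
  differential equations hold only in integrated form. They are derived from a product rule and a rule
  for the exponential of indefinite Lebesgue integrals
  (\<open>primitive_on_mult\<close>, \<open>primitive_on_exp\<close>). Both rest on \<open>primitive_on_quadratic_remainder\<close>: if \<open>F\<close>
  differs from the indefinite integral of \<open>f\<close> over each subinterval by at most a constant times the
  square of \<open>\<integral> m\<close> over that subinterval, for an integrable \<open>m \<ge> 0\<close>, then \<open>F\<close> is an indefinite
  integral of \<open>f\<close>.
\<close>

section \<open>Indefinite Lebesgue integrals\<close>

text \<open>
  Reparametrised by \<open>\<mu>\<close>, the function \<open>g\<close> has quadratically small increments in the parameter, hence
  derivative zero.
\<close>
lemma constant_if_quadratic_increments:
  fixes g \<mu> :: "real \<Rightarrow> real"
  assumes "a \<le> b" and cont: "continuous_on {a..b} \<mu>"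
    and mono: "\<And>x y. a \<le> x \<Longrightarrow> x < y \<Longrightarrow> y \<le> b \<Longrightarrow> \<mu> x < \<mu> y"
    and quad: "\<And>x y. a \<le> x \<Longrightarrow> x \<le> y \<Longrightarrow> y \<le> b \<Longrightarrow> \<bar>g y - g x\<bar> \<le> C * (\<mu> y - \<mu> x)\<^sup>2"
  shows "g b = g a"
proof -
  define \<nu> where "\<nu> = inv_into {a..b} \<mu>"
  have inj: "inj_on \<mu> {a..b}"
    by (smt (verit) atLeastAtMost_iff inj_onI mono)
  have surj: "p \<in> \<mu> ` {a..b}" if "p \<in> {\<mu> a..\<mu> b}" for p
    using IVT'[of \<mu> a p b] that assms(1) cont by (auto simp: image_iff)
  have \<nu>: "\<nu> p \<in> {a..b}" "\<mu> (\<nu> p) = p" if "p \<in> {\<mu> a..\<mu> b}" for p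
    unfolding \<nu>_def using inv_into_into[OF surj[OF that]] f_inv_into_f[OF surj[OF that]] by auto
  have \<nu>_le: "\<nu> p \<le> \<nu> q" if "p \<in> {\<mu> a..\<mu> b}" "q \<in> {\<mu> a..\<mu> b}" "p \<le> q" for p q
    using \<nu>[OF that(1)] \<nu>[OF that(2)] mono[of "\<nu> q" "\<nu> p"] that(3) by force
  have bound: "\<bar>g (\<nu> q) - g (\<nu> p)\<bar> \<le> C * (q - p)\<^sup>2"
    if "p \<in> {\<mu> a..\<mu> b}" "q \<in> {\<mu> a..\<mu> b}" for p q
  proof (cases "p \<le> q")
    case True
    then show ?thesis
      using quad[of "\<nu> p" "\<nu> q"] \<nu>[OF that(1)] \<nu>[OF that(2)] \<nu>_le[OF that True] by simp
  next
    case False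
    then show ?thesis
      using quad[of "\<nu> q" "\<nu> p"] \<nu>[OF that(1)] \<nu>[OF that(2)] \<nu>_le[OF that(2,1)]
      by (simp add: abs_minus_commute power2_commute)
  qed
  have "((\<lambda>p. g (\<nu> p)) has_real_derivative 0) (at p within {\<mu> a..\<mu> b})"
    if p: "p \<in> {\<mu> a..\<mu> b}" for p
    unfolding has_field_derivative_iff
  proof (rule Lim_null_comparison)
    show "\<forall>\<^sub>F q in at p within {\<mu> a..\<mu> b}. norm ((g (\<nu> q) - g (\<nu> p)) / (q - p)) \<le> \<bar>C\<bar> * \<bar>q - p\<bar>"
      unfolding eventually_at_filter
    proof (intro always_eventually allI impI)
      fix q assume "q \<noteq> p" and q: "q \<in> {\<mu> a..\<mu> b}"
      have "\<bar>g (\<nu> q) - g (\<nu> p)\<bar> \<le> C * (q - p)\<^sup>2"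
        by (rule bound[OF p q])
      also have "\<dots> \<le> \<bar>C\<bar> * \<bar>q - p\<bar> * \<bar>q - p\<bar>"
        by (simp add: power2_eq_square mult_right_mono mult.assoc)
      finally show "norm ((g (\<nu> q) - g (\<nu> p)) / (q - p)) \<le> \<bar>C\<bar> * \<bar>q - p\<bar>"
        using \<open>q \<noteq> p\<close> by (simp add: divide_simps)
    qed
    show "((\<lambda>q. \<bar>C\<bar> * \<bar>q - p\<bar>) \<longlongrightarrow> 0) (at p within {\<mu> a..\<mu> b})"
      by (auto intro!: tendsto_eq_intros)
  qed
  then obtain c where c: "\<And>p. p \<in> {\<mu> a..\<mu> b} \<Longrightarrow> g (\<nu> p) = c"
    using has_field_derivative_zero_constant[of "{\<mu> a..\<mu> b}" "\<lambda>p. g (\<nu> p)"] by force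
  have "\<mu> a \<le> \<mu> b"
    using mono[of a b] assms(1) by (cases "a = b") auto
  moreover have "\<nu> (\<mu> a) = a" "\<nu> (\<mu> b) = b"
    using assms(1) inj by (auto simp: \<nu>_def inv_into_f_f)
  ultimately show ?thesis
    using c[of "\<mu> a"] c[of "\<mu> b"] by simp
qed

text \<open>
  \<open>F\<close> is an indefinite Lebesgue integral of \<open>f\<close> on \<open>{a..b}\<close>; equivalently, \<open>F\<close> is absolutely continuous
  with derivative \<open>f\<close> almost everywhere. For \<open>b < a\<close> the predicate is vacuously true.
\<close>
definition primitive_on :: "real \<Rightarrow> real \<Rightarrow> (real \<Rightarrow> real) \<Rightarrow> (real \<Rightarrow> real) \<Rightarrow> bool" where
  "primitive_on a b f F \<longleftrightarrow>
     f absolutely_integrable_on {a..b} \<and> (\<forall>x\<in>{a..b}. F x = F a + integral {a..x} f)"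

lemma primitive_onD:
  assumes "primitive_on a b f F"
  shows "f absolutely_integrable_on {a..b}" "\<And>x. x \<in> {a..b} \<Longrightarrow> F x = F a + integral {a..x} f"
  using assms unfolding primitive_on_def by blast+

lemma absolutely_integrable_abs_subinterval:
  fixes f :: "real \<Rightarrow> real"
  assumes "f absolutely_integrable_on {a..b}" "a \<le> x" "y \<le> b"
  shows "f absolutely_integrable_on {x..y}" "f integrable_on {x..y}"
    "(\<lambda>v. \<bar>f v\<bar>) absolutely_integrable_on {x..y}" "(\<lambda>v. \<bar>f v\<bar>) integrable_on {x..y}"
proof -
  show *: "f absolutely_integrable_on {x..y}"
    by (rule absolutely_integrable_on_subinterval[OF assms(1)]) (use assms in auto)
  show "f integrable_on {x..y}" "(\<lambda>v. \<bar>f v\<bar>) integrable_on {x..y}"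
    using * by (auto simp: absolutely_integrable_on_def)
  show "(\<lambda>v. \<bar>f v\<bar>) absolutely_integrable_on {x..y}"
    using absolutely_integrable_norm[OF *] by (simp add: o_def)
qed

lemma primitive_on_increment:
  assumes "primitive_on a b f F" "a \<le> x" "x \<le> y" "y \<le> b"
  shows "F y - F x = integral {x..y} f"
proof -
  have "integral {a..x} f + integral {x..y} f = integral {a..y} f"
    by (rule Henstock_Kurzweil_Integration.integral_combine)
      (use assms absolutely_integrable_abs_subinterval(2)[OF primitive_onD(1)[OF assms(1)]] in auto)
  then show ?thesis
    using primitive_onD(2)[OF assms(1), of x] primitive_onD(2)[OF assms(1), of y] assms by auto
qed

lemma abs_primitive_on_increment_le:
  assumes "primitive_on a b f F" "a \<le> x" "x \<le> y" "y \<le> b"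
  shows "\<bar>F y - F x\<bar> \<le> integral {x..y} (\<lambda>v. \<bar>f v\<bar>)"
proof -
  have "f absolutely_integrable_on {a..b}"
    by (rule primitive_onD[OF assms(1)])
  note i = absolutely_integrable_abs_subinterval[OF this assms(2,4)]
  show ?thesis
    unfolding primitive_on_increment[OF assms]
    using Henstock_Kurzweil_Integration.integral_norm_bound_integral[OF i(2) i(4)]
    by (simp add: real_norm_def)
qed

lemma continuous_on_primitive_on:
  assumes "primitive_on a b f F"
  shows "continuous_on {a..b} F"
proof -
  have "continuous_on {a..b} (\<lambda>x. F a + integral {a..x} f)"
    using primitive_onD(1)[OF assms]
    by (intro continuous_intros indefinite_integral_continuous_1)
      (auto simp: absolutely_integrable_on_def)
  then show ?thesis
    by (rule continuous_on_eq) (metis primitive_onD(2)[OF assms])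
qed

lemma primitive_on_integral:
  assumes "f absolutely_integrable_on {a..b}"
  shows "primitive_on a b f (\<lambda>x. c + integral {a..x} f)"
  using assms by (auto simp: primitive_on_def)

lemma primitive_on_const: "primitive_on a b (\<lambda>_. 0) (\<lambda>_. c)"
  by (auto simp: primitive_on_def)

lemma primitive_on_diff:
  assumes "primitive_on a b f F" "primitive_on a b g G"
  shows "primitive_on a b (\<lambda>x. f x - g x) (\<lambda>x. F x - G x)"
proof -
  have fg: "f absolutely_integrable_on {a..b}" "g absolutely_integrable_on {a..b}"
    using assms primitive_onD(1) by auto
  have *: "integral {a..x} (\<lambda>v. f v - g v) = integral {a..x} f - integral {a..x} g" if "x \<le> b" for x
    using absolutely_integrable_abs_subinterval(2)[OF fg(1) order_refl that] absolutely_integrable_abs_subinterval(2)[OF fg(2) order_refl that]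
    by (rule Henstock_Kurzweil_Integration.integral_diff)
  show ?thesis
    unfolding primitive_on_def
  proof (intro conjI ballI set_integral_diff(1) fg)
    fix x assume x: "x \<in> {a..b}"
    show "F x - G x = F a - G a + integral {a..x} (\<lambda>v. f v - g v)"
      using primitive_onD(2)[OF assms(1) x] primitive_onD(2)[OF assms(2) x] *[of x] x by simp
  qed
qed

lemma primitive_on_cong:
  assumes "primitive_on a b f F" "\<And>x. x \<in> {a..b} \<Longrightarrow> f x = g x" "\<And>x. x \<in> {a..b} \<Longrightarrow> F x = G x"
  shows "primitive_on a b g G"
proof (cases "a \<le> b")
  case True
  show ?thesis
    unfolding primitive_on_def
  proof (intro conjI ballI)
    show "g absolutely_integrable_on {a..b}"
      using primitive_onD(1)[OF assms(1)] assms(2)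
      by (auto intro: absolutely_integrable_spike[where S = "{}"])
    fix x assume x: "x \<in> {a..b}"
    have "integral {a..x} f = integral {a..x} g"
      using assms(2) x by (intro integral_cong) auto
    then show "G x = G a + integral {a..x} g"
      using primitive_onD(2)[OF assms(1) x] assms(3)[OF x] assms(3)[of a] True by simp
  qed
qed (auto simp: primitive_on_def)

lemma primitive_on_quadratic_remainder:
  fixes f m F :: "real \<Rightarrow> real"
  assumes f: "f absolutely_integrable_on {a..b}"
    and m: "m absolutely_integrable_on {a..b}" "\<And>x. 0 \<le> m x"
    and quad: "\<And>x y. a \<le> x \<Longrightarrow> x \<le> y \<Longrightarrow> y \<le> b \<Longrightarrow>
      \<bar>F y - F x - integral {x..y} f\<bar> \<le> C * (integral {x..y} m)\<^sup>2"
  shows "primitive_on a b f F"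
  unfolding primitive_on_def
proof (intro conjI ballI)
  fix z assume z: "z \<in> {a..b}"
  \<comment> \<open>The summand \<open>x\<close> makes \<open>\<mu>\<close> strictly increasing even where \<open>m\<close> vanishes.\<close>
  define \<mu> where "\<mu> x = x + integral {a..x} m" for x
  define g where "g x = F x - integral {a..x} f" for x
  have combine: "integral {a..y} p = integral {a..x} p + integral {x..y} p"
    if "p absolutely_integrable_on {a..b}" "a \<le> x" "x \<le> y" "y \<le> b" for p :: "real \<Rightarrow> real" and x y
    using Henstock_Kurzweil_Integration.integral_combine[of a x y p] that
      absolutely_integrable_abs_subinterval(2)[OF that(1) order_refl that(4)] by simp
  have m_nonneg: "0 \<le> integral {x..y} m" if "a \<le> x" "y \<le> b" for x y
    using absolutely_integrable_abs_subinterval(2)[OF m(1) that] m(2)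
    by (intro Henstock_Kurzweil_Integration.integral_nonneg)
  have "g z = g a"
  proof (rule constant_if_quadratic_increments[where g = g and \<mu> = \<mu>])
    show "a \<le> z"
      using z by simp
    show "continuous_on {a..z} \<mu>"
      unfolding \<mu>_def using z absolutely_integrable_abs_subinterval(2)[OF m(1), of a z]
      by (intro continuous_intros indefinite_integral_continuous_1) auto
    show "\<mu> x < \<mu> y" if "a \<le> x" "x < y" "y \<le> z" for x y
      using combine[OF m(1), of x y] m_nonneg[of x y] that z by (simp add: \<mu>_def)
    show "\<bar>g y - g x\<bar> \<le> \<bar>C\<bar> * (\<mu> y - \<mu> x)\<^sup>2" if xy: "a \<le> x" "x \<le> y" "y \<le> z" for x y
    proof -
      have yb: "y \<le> b"
        using xy z by simp
      have "\<bar>g y - g x\<bar> = \<bar>F y - F x - integral {x..y} f\<bar>"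
        using combine[OF f xy(1,2) yb] by (simp add: g_def algebra_simps)
      also have "\<dots> \<le> C * (integral {x..y} m)\<^sup>2"
        by (rule quad[OF xy(1,2) yb])
      also have "\<dots> \<le> \<bar>C\<bar> * (integral {x..y} m)\<^sup>2"
        by (simp add: mult_right_mono)
      also have "\<dots> \<le> \<bar>C\<bar> * (\<mu> y - \<mu> x)\<^sup>2"
        using combine[OF m(1) xy(1,2) yb] m_nonneg[OF xy(1) yb] xy
        by (intro mult_left_mono power_mono) (auto simp: \<mu>_def)
      finally show ?thesis .
    qed
  qed
  then show "F z = F a + integral {a..z} f"
    by (simp add: g_def)
qed (fact f)

lemma absolutely_integrable_continuous_mult:
  fixes f g :: "real \<Rightarrow> real"
  assumes "continuous_on {a..b} f" "g absolutely_integrable_on {a..b}"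
  shows "(\<lambda>x. f x * g x) absolutely_integrable_on {a..b}"
  by (rule absolutely_integrable_bounded_measurable_product_real)
    (use assms in \<open>auto intro!: continuous_imp_measurable_on_sets_lebesgue compact_imp_bounded
       compact_continuous_image\<close>)

lemma abs_integral_mult_le:
  fixes p f :: "real \<Rightarrow> real"
  assumes f: "f absolutely_integrable_on {x..y}" and p: "continuous_on {x..y} p"
    and le: "\<And>v. v \<in> {x..y} \<Longrightarrow> \<bar>p v\<bar> \<le> N"
  shows "\<bar>integral {x..y} (\<lambda>v. p v * f v)\<bar> \<le> N * integral {x..y} (\<lambda>v. \<bar>f v\<bar>)"
proof -
  have "norm (integral {x..y} (\<lambda>v. p v * f v)) \<le> integral {x..y} (\<lambda>v. N * \<bar>f v\<bar>)"
  proof (rule Henstock_Kurzweil_Integration.integral_norm_bound_integral)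
    show "(\<lambda>v. p v * f v) integrable_on {x..y}"
      using absolutely_integrable_continuous_mult[OF p f] by (auto simp: absolutely_integrable_on_def)
    show "(\<lambda>v. N * \<bar>f v\<bar>) integrable_on {x..y}"
      using f by (intro integrable_on_mult_right) (auto simp: absolutely_integrable_on_def)
    show "norm (p v * f v) \<le> N * \<bar>f v\<bar>" if "v \<in> {x..y}" for v
      using le[OF that] by (simp add: abs_mult mult_right_mono)
  qed
  then show ?thesis
    by simp
qed

text \<open>
  Over \<open>{x..y}\<close> the remainder consists of the product of the two increments and of the integrals of
  \<open>(G - G x) f\<close> and \<open>(F - F x) g\<close>; each is at most \<open>(\<integral> \<bar>f\<bar>) (\<integral> \<bar>g\<bar>)\<close>, whence the constant 3.
\<close>
lemma primitive_on_mult: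
  assumes F: "primitive_on a b f F" and G: "primitive_on a b g G"
  shows "primitive_on a b (\<lambda>x. G x * f x + F x * g x) (\<lambda>x. F x * G x)"
proof -
  have f: "f absolutely_integrable_on {a..b}" and g: "g absolutely_integrable_on {a..b}"
    using assms by (auto dest: primitive_onD(1))
  have cF: "continuous_on {a..b} F" and cG: "continuous_on {a..b} G"
    using assms by (auto intro: continuous_on_primitive_on)
  have Gf: "(\<lambda>x. G x * f x) absolutely_integrable_on {a..b}"
    and Fg: "(\<lambda>x. F x * g x) absolutely_integrable_on {a..b}"
    by (auto intro: absolutely_integrable_continuous_mult cF cG f g)
  show ?thesis
  proof (rule primitive_on_quadratic_remainder[where m = "\<lambda>v. \<bar>f v\<bar> + \<bar>g v\<bar>" and C = 3])
    show "(\<lambda>x. G x * f x + F x * g x) absolutely_integrable_on {a..b}"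
      using Gf Fg by (rule set_integral_add)
    show "(\<lambda>v. \<bar>f v\<bar> + \<bar>g v\<bar>) absolutely_integrable_on {a..b}"
      by (intro set_integral_add absolutely_integrable_abs_subinterval(3)[OF f] absolutely_integrable_abs_subinterval(3)[OF g]) auto
    show "\<bar>F y * G y - F x * G x - integral {x..y} (\<lambda>v. G v * f v + F v * g v)\<bar>
        \<le> 3 * (integral {x..y} (\<lambda>v. \<bar>f v\<bar> + \<bar>g v\<bar>))\<^sup>2" if xy: "a \<le> x" "x \<le> y" "y \<le> b" for x y
    proof -
      define p where "p = integral {x..y} (\<lambda>v. \<bar>f v\<bar>)"
      define q where "q = integral {x..y} (\<lambda>v. \<bar>g v\<bar>)"
      define A where "A = integral {x..y} (\<lambda>v. (G v - G x) * f v)"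
      define B where "B = integral {x..y} (\<lambda>v. (F v - F x) * g v)"
      note fi = absolutely_integrable_abs_subinterval[OF f xy(1,3)] and gi = absolutely_integrable_abs_subinterval[OF g xy(1,3)]
      have m: "integral {x..y} (\<lambda>v. \<bar>f v\<bar> + \<bar>g v\<bar>) = p + q"
        unfolding p_def q_def by (rule Henstock_Kurzweil_Integration.integral_add[OF fi(4) gi(4)])
      have pq: "0 \<le> p" "0 \<le> q"
        unfolding p_def q_def using fi(4) gi(4)
        by (auto intro!: Henstock_Kurzweil_Integration.integral_nonneg)
      have sub: "{x..y} \<subseteq> {a..b}"
        using xy by auto
      have "\<bar>G v - G x\<bar> \<le> q" if "v \<in> {x..y}" for v
      proof -
        have "\<bar>G v - G x\<bar> \<le> integral {x..v} (\<lambda>v. \<bar>g v\<bar>)"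
          using abs_primitive_on_increment_le[OF G, of x v] that xy by auto
        also have "\<dots> \<le> q"
          unfolding q_def using that xy absolutely_integrable_abs_subinterval[OF g]
          by (intro Henstock_Kurzweil_Integration.integral_subset_le) auto
        finally show ?thesis .
      qed
      then have A: "\<bar>A\<bar> \<le> q * p"
        unfolding A_def p_def using fi cG sub
        by (intro abs_integral_mult_le continuous_intros) (auto intro: continuous_on_subset)
      have "\<bar>F v - F x\<bar> \<le> p" if "v \<in> {x..y}" for v
      proof -
        have "\<bar>F v - F x\<bar> \<le> integral {x..v} (\<lambda>v. \<bar>f v\<bar>)"
          using abs_primitive_on_increment_le[OF F, of x v] that xy by auto
        also have "\<dots> \<le> p"
          unfolding p_def using that xy absolutely_integrable_abs_subinterval[OF f]
          by (intro Henstock_Kurzweil_Integration.integral_subset_le) auto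
        finally show ?thesis .
      qed
      then have B: "\<bar>B\<bar> \<le> p * q"
        unfolding B_def q_def using gi cF sub
        by (intro abs_integral_mult_le continuous_intros) (auto intro: continuous_on_subset)
      have FG: "\<bar>(F y - F x) * (G y - G x)\<bar> \<le> p * q"
        unfolding abs_mult p_def q_def
        using abs_primitive_on_increment_le[OF F xy] abs_primitive_on_increment_le[OF G xy]
        by (intro mult_mono) auto
      have A_eq: "A = integral {x..y} (\<lambda>v. G v * f v) - G x * (F y - F x)"
        unfolding A_def primitive_on_increment[OF F xy] left_diff_distrib
        using absolutely_integrable_abs_subinterval(2)[OF Gf xy(1,3)] integrable_on_mult_right[OF fi(2)]
        by (subst Henstock_Kurzweil_Integration.integral_diff) auto
      have B_eq: "B = integral {x..y} (\<lambda>v. F v * g v) - F x * (G y - G x)"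
        unfolding B_def primitive_on_increment[OF G xy] left_diff_distrib
        using absolutely_integrable_abs_subinterval(2)[OF Fg xy(1,3)] integrable_on_mult_right[OF gi(2)]
        by (subst Henstock_Kurzweil_Integration.integral_diff) auto
      have "F y * G y - F x * G x - integral {x..y} (\<lambda>v. G v * f v + F v * g v)
        = (F y - F x) * (G y - G x) - A - B"
        unfolding A_eq B_eq
        using absolutely_integrable_abs_subinterval(2)[OF Gf xy(1,3)] absolutely_integrable_abs_subinterval(2)[OF Fg xy(1,3)]
        by (subst Henstock_Kurzweil_Integration.integral_add) (auto simp: algebra_simps)
      moreover have "p * q \<le> (p + q)\<^sup>2"
        using pq by (simp add: power2_sum)
      ultimately show ?thesis
        unfolding m using A B FG by (simp add: mult.commute)
    qed
  qed auto
qed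

text \<open>
  Over \<open>{x..y}\<close> the remainder consists of the error of the linear approximation of \<open>exp\<close> at \<open>F x\<close> and of
  the integral of \<open>(exp F - exp (F x)) f\<close>. If \<open>F \<le> M\<close>, each is at most \<open>exp M * (\<integral> \<bar>f\<bar>)\<^sup>2\<close>, since
  \<open>exp\<close> has Lipschitz constant \<open>exp M\<close> below \<open>M\<close>.
\<close>
lemma primitive_on_exp:
  assumes F: "primitive_on a b f F"
  shows "primitive_on a b (\<lambda>x. exp (F x) * f x) (\<lambda>x. exp (F x))"
proof -
  have f: "f absolutely_integrable_on {a..b}"
    using assms by (auto dest: primitive_onD(1))
  have cF: "continuous_on {a..b} F"
    using assms by (auto intro: continuous_on_primitive_on)
  have Ff: "(\<lambda>x. exp (F x) * f x) absolutely_integrable_on {a..b}"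
    by (auto intro!: absolutely_integrable_continuous_mult continuous_intros cF f)
  obtain M where M: "\<And>x. x \<in> {a..b} \<Longrightarrow> F x \<le> M"
    using compact_imp_bounded[OF compact_continuous_image[OF cF compact_Icc]]
    unfolding bounded_iff by (force simp: abs_le_iff)
  have lip: "\<bar>exp u - exp v\<bar> \<le> exp M * \<bar>u - v\<bar>" if "u \<le> M" "v \<le> M" for u v :: real
  proof -
    have "norm (exp u - exp v) \<le> exp M * norm (u - v)"
      by (rule field_differentiable_bound[where S = "{..M}" and f' = exp])
        (use that in \<open>auto intro: DERIV_subset[OF DERIV_exp]\<close>)
    then show ?thesis by simp
  qed
  show ?thesis
  proof (rule primitive_on_quadratic_remainder[where m = "\<lambda>v. \<bar>f v\<bar>" and C = "2 * exp M"])
    show "(\<lambda>v. \<bar>f v\<bar>) absolutely_integrable_on {a..b}"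
      by (intro absolutely_integrable_abs_subinterval(3)[OF f]) auto
    show "\<bar>exp (F y) - exp (F x) - integral {x..y} (\<lambda>v. exp (F v) * f v)\<bar>
        \<le> 2 * exp M * (integral {x..y} (\<lambda>v. \<bar>f v\<bar>))\<^sup>2" if xy: "a \<le> x" "x \<le> y" "y \<le> b" for x y
    proof -
      define p where "p = integral {x..y} (\<lambda>v. \<bar>f v\<bar>)"
      define A where "A = integral {x..y} (\<lambda>v. (exp (F v) - exp (F x)) * f v)"
      note fi = absolutely_integrable_abs_subinterval[OF f xy(1,3)]
      have sub: "{x..y} \<subseteq> {a..b}"
        using xy by auto
      have inc: "\<bar>F v - F x\<bar> \<le> p" if "v \<in> {x..y}" for v
      proof -
        have "\<bar>F v - F x\<bar> \<le> integral {x..v} (\<lambda>v. \<bar>f v\<bar>)"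
          using abs_primitive_on_increment_le[OF F, of x v] that xy by auto
        also have "\<dots> \<le> p"
          unfolding p_def using that xy absolutely_integrable_abs_subinterval[OF f]
          by (intro Henstock_Kurzweil_Integration.integral_subset_le) auto
        finally show ?thesis .
      qed
      have "\<bar>exp (F v) - exp (F x)\<bar> \<le> exp M * p" if "v \<in> {x..y}" for v
        using lip[OF M M, of v x] inc[OF that] that xy
        by (smt (verit) atLeastAtMost_iff exp_gt_zero mult_left_mono)
      then have A: "\<bar>A\<bar> \<le> exp M * p * p"
        unfolding A_def using fi cF sub 
        by (subst (2) p_def, intro abs_integral_mult_le continuous_intros) (auto intro: continuous_on_subset)
      have A_eq: "A = integral {x..y} (\<lambda>v. exp (F v) * f v) - exp (F x) * (F y - F x)"
        unfolding A_def primitive_on_increment[OF F xy] left_diff_distrib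
        using absolutely_integrable_abs_subinterval(2)[OF Ff xy(1,3)] integrable_on_mult_right[OF fi(2)]
        by (subst Henstock_Kurzweil_Integration.integral_diff) auto
      have "\<bar>exp (F y) - exp (F x) - exp (F x) * (F y - F x)\<bar> \<le> exp M * p * p"
      proof -
        \<comment> \<open>A convex set containing \<open>F x\<close> and \<open>F y\<close>, on which \<open>u \<mapsto> exp u - exp (F x) * u\<close> has
          derivative at most \<open>exp M * p\<close> in absolute value.\<close>
        define S where "S = {u. u \<le> M \<and> \<bar>u - F x\<bar> \<le> p}"
        have "S = {..M} \<inter> {F x - p..F x + p}"
          by (auto simp: S_def)
        then have "convex S"
          by (simp add: convex_Int)
        moreover have "F x \<in> S" "F y \<in> S"
          using M[of x] M[of y] inc[of x] inc[of y] xy by (auto simp: S_def)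
        moreover have "((\<lambda>u. exp u - exp (F x) * u) has_real_derivative exp u - exp (F x)) (at u within S)" for u
          by (auto intro!: derivative_eq_intros)
        moreover have "norm (exp u - exp (F x)) \<le> exp M * p" if "u \<in> S" for u
        proof -
          have "\<bar>exp u - exp (F x)\<bar> \<le> exp M * \<bar>u - F x\<bar>"
            using that \<open>F x \<in> S\<close> by (intro lip) (auto simp: S_def)
          also have "\<dots> \<le> exp M * p"
            using that by (auto simp: S_def)
          finally show ?thesis by simp
        qed
        ultimately have "norm (exp (F y) - exp (F x) * F y - (exp (F x) - exp (F x) * F x))
            \<le> exp M * p * norm (F y - F x)"
          by (intro field_differentiable_bound[where S = S and f' = "\<lambda>u. exp u - exp (F x)"]) auto
        also have "\<dots> \<le> exp M * p * p"
          using inc[of y] inc[of x] xy by (intro mult_left_mono) auto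
        finally show ?thesis
          by (simp add: algebra_simps)
      qed
      then show ?thesis
        using A unfolding A_eq p_def[symmetric] by (simp add: power2_eq_square)
    qed
  qed (use Ff in auto)
qed


section \<open>Human wealth and the capital flow\<close>

lemma ode_solution_from_primitive_on:
  assumes "\<And>s. t \<le> s \<Longrightarrow> primitive_on t s (\<lambda>v. f v (x v)) x"
  shows "ode_solution_from t f x"
  unfolding ode_solution_from_def
proof (intro allI impI conjI)
  fix s assume s: "t \<le> s"
  show "(\<lambda>v. f v (x v)) absolutely_integrable_on {t..s}"
    by (rule primitive_onD(1)[OF assms[OF s]])
  show "x s = x t + integral {t..s} (\<lambda>v. f v (x v))"
    using primitive_onD(2)[OF assms[OF s], of s] s by simp
  \<comment> \<open>At a point of continuity the derivative is taken on \<open>{t..s+1}\<close>, which agrees with \<open>{t..}\<close> near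
    \<open>s\<close>.\<close>
  define p where "p v = f v (x v)" for v
  assume "continuous (at s within {t..}) (\<lambda>v. f v (x v))"
  then have cont: "continuous (at s within {t..s+1} - {}) p"
    unfolding p_def by (rule continuous_within_subset) auto
  have prim: "primitive_on t (s + 1) p x"
    unfolding p_def using s by (intro assms) simp
  have "p integrable_on {t..s+1}"
    using primitive_onD(1)[OF prim] by (simp add: absolutely_integrable_on_def)
  then have "((\<lambda>u. integral {t..u} p) has_vector_derivative p s) (at s within {t..s+1} - {})"
    using s cont by (intro integral_has_vector_derivative_continuous_at) auto
  then have "((\<lambda>u. x t + integral {t..u} p) has_real_derivative 0 + p s) (at s within {t..s+1})"
    by (intro DERIV_add DERIV_const) (simp add: has_real_derivative_iff_has_vector_derivative)
  then have "(x has_real_derivative 0 + p s) (at s within {t..s+1})"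
  proof (rule has_field_derivative_transform_within[OF _ zero_less_one])
    show "x t + integral {t..u} p = x u" if "u \<in> {t..s+1}" for u
      using primitive_onD(2)[OF prim that] by simp
  qed (use s in auto)
  moreover have "at s within {t..s+1} = at s within {t..}"
    by (rule at_within_nhd[where S = "{..<s+1}"]) auto
  ultimately show "(x has_real_derivative f s (x s)) (at s within {t..})"
    by (simp add: p_def)
qed

lemma human_wealth_split:
  assumes r: "\<And>T. r absolutely_integrable_on {0..T}"
    and w: "\<And>T. w absolutely_integrable_on {0..T}"
    and pv: "\<And>t. 0 \<le> t \<Longrightarrow> (\<lambda>s. exp (- integral {t..s} r) * w s) integrable_on {t..}"
    and t: "0 \<le> t" "t \<le> s"
  shows "(\<lambda>v. exp (- integral {t..v} r) * w v) absolutely_integrable_on {t..s}"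
    and "human_wealth r w t = integral {t..s} (\<lambda>v. exp (- integral {t..v} r) * w v)
           + exp (- integral {t..s} r) * human_wealth r w s"
proof -
  define D where "D v = exp (- integral {t..v} r)" for v
  have "continuous_on {t..s} D"
    unfolding D_def using absolutely_integrable_abs_subinterval(2)[OF r[of s], of t s] t
    by (intro continuous_intros indefinite_integral_continuous_1) auto
  then show Dw: "(\<lambda>v. exp (- integral {t..v} r) * w v) absolutely_integrable_on {t..s}"
    unfolding D_def using absolutely_integrable_abs_subinterval(1)[OF w[of s], of t s] t
    by (intro absolutely_integrable_continuous_mult) auto
  have D_mult: "D s * (exp (- integral {s..v} r) * w v) = D v * w v" if "v \<in> {s..}" for v
  proof -
    have "integral {t..s} r + integral {s..v} r = integral {t..v} r"
      using t that absolutely_integrable_abs_subinterval(2)[OF r[of v], of t v]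
      by (intro Henstock_Kurzweil_Integration.integral_combine) auto
    then show ?thesis
      by (simp add: D_def flip: exp_add)
  qed
  have "((\<lambda>v. exp (- integral {s..v} r) * w v) has_integral human_wealth r w s) {s..}"
    unfolding human_wealth_def using pv[of s] t by (simp add: integrable_integral)
  then have "((\<lambda>v. D s * (exp (- integral {s..v} r) * w v)) has_integral D s * human_wealth r w s) {s..}"
    by (rule has_integral_mult_right)
  then have "((\<lambda>v. D v * w v) has_integral D s * human_wealth r w s) {s..}"
    using D_mult by (subst (asm) has_integral_cong) auto
  moreover have "((\<lambda>v. D v * w v) has_integral integral {t..s} (\<lambda>v. D v * w v)) {t..s}"
    unfolding D_def using Dw by (simp add: absolutely_integrable_on_def integrable_integral)
  moreover have "{t..s} \<inter> {s..} = {s}" "{t..s} \<union> {s..} = {t..}"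
    using t by auto
  ultimately have "((\<lambda>v. D v * w v) has_integral
      integral {t..s} (\<lambda>v. D v * w v) + D s * human_wealth r w s) {t..}"
    using has_integral_Un[of "\<lambda>v. D v * w v" _ "{t..s}" _ "{s..}"] by simp
  then show "human_wealth r w t = integral {t..s} (\<lambda>v. exp (- integral {t..v} r) * w v)
      + exp (- integral {t..s} r) * human_wealth r w s"
    unfolding human_wealth_def D_def by (simp add: integral_unique)
qed

text \<open>
  The equation \<open>H' = r H - w\<close>, from the product rule applied to
  \<open>H v = exp (\<integral>\<^sub>t\<^sup>v r) * (H t - \<integral>\<^sub>t\<^sup>v exp (- \<integral> r) w)\<close>.
\<close>
lemma primitive_on_human_wealth:
  assumes r: "\<And>T. r absolutely_integrable_on {0..T}"
    and w: "\<And>T. w absolutely_integrable_on {0..T}"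
    and pv: "\<And>t. 0 \<le> t \<Longrightarrow> (\<lambda>s. exp (- integral {t..s} r) * w s) integrable_on {t..}"
    and t: "0 \<le> t" "t \<le> s"
  shows "primitive_on t s (\<lambda>v. r v * human_wealth r w v - w v) (human_wealth r w)"
proof -
  define g where "g v = exp (- integral {t..v} r) * w v" for v
  have "primitive_on t s r (\<lambda>v. 0 + integral {t..v} r)"
    using absolutely_integrable_abs_subinterval(1)[OF r[of s]] t by (intro primitive_on_integral) auto
  note E = primitive_on_exp[OF this]
  have "primitive_on t s g (\<lambda>v. 0 + integral {t..v} g)"
    unfolding g_def by (intro primitive_on_integral human_wealth_split(1) r w pv t)
  note G = primitive_on_diff[OF primitive_on_const[where c = "human_wealth r w t"] this]
  show ?thesis
  proof (rule primitive_on_cong[OF primitive_on_mult[OF E G]])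
    fix v assume v: "v \<in> {t..s}"
    have "human_wealth r w t = integral {t..v} g + exp (- integral {t..v} r) * human_wealth r w v"
      unfolding g_def using v t by (intro human_wealth_split(2) r w pv) auto
    then show *: "exp (0 + integral {t..v} r) * (human_wealth r w t - (0 + integral {t..v} g))
        = human_wealth r w v"
      by (simp add: exp_minus)
    have "exp (integral {t..v} r) * g v = w v"
      by (simp add: g_def exp_minus)
    then show "(human_wealth r w t - (0 + integral {t..v} g)) * (exp (0 + integral {t..v} r) * r v)
        + exp (0 + integral {t..v} r) * (0 - g v) = r v * human_wealth r w v - w v"
      using * by (simp add: mult_ac)
  qed
qed

lemma capital_flow_proportional:
  assumes r: "\<And>T. r absolutely_integrable_on {0..T}"
    and w: "\<And>T. w absolutely_integrable_on {0..T}"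
    and pv: "\<And>t. 0 \<le> t \<Longrightarrow> (\<lambda>s. exp (- integral {t..s} r) * w s) integrable_on {t..}"
    and lam: "\<And>T. lam absolutely_integrable_on {0..T}"
    and \<sigma>: "\<And>t k. 0 \<le> t \<Longrightarrow> 0 < total_wealth r w t k \<Longrightarrow> \<sigma> t k = lam t * total_wealth r w t k"
  shows "capital_flow r w \<sigma> (\<lambda>s t k. total_wealth r w t k * exp (- integral {t..s} (\<lambda>v. lam v - r v))
           - human_wealth r w s)"
  unfolding capital_flow_def
proof (intro allI impI conjI)
  fix t k assume tk: "0 \<le> t \<and> 0 < total_wealth r w t k"
  define W where "W = total_wealth r w t k"
  define X where "X s = W * exp (- integral {t..s} (\<lambda>v. lam v - r v))" for s
  show "W * exp (- integral {t..t} (\<lambda>v. lam v - r v)) - human_wealth r w t = k"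
    by (simp add: W_def total_wealth_def)
  show "0 < total_wealth r w s (W * exp (- integral {t..s} (\<lambda>v. lam v - r v)) - human_wealth r w s)" for s
    using tk by (simp add: total_wealth_def[of r w s] W_def)
  show "ode_solution_from t (\<lambda>s x. w s + r s * x - \<sigma> s x)
      (\<lambda>s. W * exp (- integral {t..s} (\<lambda>v. lam v - r v)) - human_wealth r w s)"
  proof (rule ode_solution_from_primitive_on)
    fix s assume s: "t \<le> s"
    have "(\<lambda>v. lam v - r v) absolutely_integrable_on {t..s}"
      using absolutely_integrable_abs_subinterval(1)[OF r[of s]] absolutely_integrable_abs_subinterval(1)[OF lam[of s]] tk
      by (intro set_integral_diff) auto
    note P = primitive_on_exp[OF primitive_on_diff[OF primitive_on_const[where c = 0]
          primitive_on_integral[OF this, of 0]]]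
    note Q = primitive_on_diff[OF primitive_on_mult[OF primitive_on_const[where c = W] P]
        primitive_on_human_wealth[OF r w pv _ s]]
    show "primitive_on t s
        (\<lambda>v. w v + r v * (W * exp (- integral {t..v} (\<lambda>v. lam v - r v)) - human_wealth r w v)
          - \<sigma> v (W * exp (- integral {t..v} (\<lambda>v. lam v - r v)) - human_wealth r w v))
        (\<lambda>s. W * exp (- integral {t..s} (\<lambda>v. lam v - r v)) - human_wealth r w s)"
    proof (rule primitive_on_cong[OF Q])
      fix v assume v: "v \<in> {t..s}"
      have "\<sigma> v (X v - human_wealth r w v) = lam v * X v"
        using v tk by (subst \<sigma>) (auto simp: total_wealth_def[of r w v] X_def W_def)
      then show "exp (0 - (0 + integral {t..v} (\<lambda>v. lam v - r v))) * 0
           + W * (exp (0 - (0 + integral {t..v} (\<lambda>v. lam v - r v))) * (0 - (lam v - r v)))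
           - (r v * human_wealth r w v - w v)
         = w v + r v * (W * exp (- integral {t..v} (\<lambda>v. lam v - r v)) - human_wealth r w v)
          - \<sigma> v (W * exp (- integral {t..v} (\<lambda>v. lam v - r v)) - human_wealth r w v)"
        by (simp add: X_def algebra_simps)
    qed (use tk in auto)
  qed
qed

section \<open>Proportional equilibrium strategies\<close>

text \<open>
  The hypotheses on \<open>V\<close> are the first-order condition in \<open>k\<close> and the integrated equilibrium equation
  along the explicit path of total wealth.
\<close>
lemma equilibrium_strategy_proportional:
  assumes \<gamma>: "0 < \<gamma>"
    and r: "\<And>T. r absolutely_integrable_on {0..T}"
    and w: "\<And>T. w absolutely_integrable_on {0..T}"
    and pv: "\<And>t. 0 \<le> t \<Longrightarrow> (\<lambda>s. exp (- integral {t..s} r) * w s) integrable_on {t..}"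
    and lam: "\<And>T. lam absolutely_integrable_on {0..T}"
    and lam_pos: "\<And>t. 0 \<le> t \<Longrightarrow> 0 < lam t"
    and V': "\<And>t k. 0 \<le> t \<Longrightarrow> 0 < total_wealth r w t k \<Longrightarrow>
      (V t has_real_derivative (lam t * total_wealth r w t k) powr (- \<gamma>)) (at k)"
    and V: "\<And>t k. 0 \<le> t \<Longrightarrow> 0 < total_wealth r w t k \<Longrightarrow>
      ((\<lambda>s. h (s - t) * crra \<gamma> (lam s * (total_wealth r w t k * exp (- integral {t..s} (\<lambda>v. lam v - r v)))))
         has_integral V t k) {t..}"
  shows "equilibrium_strategy h (crra \<gamma>) r w (\<lambda>t k. lam t * total_wealth r w t k) V"
proof -
  have inv: "inverse_marginal (crra \<gamma>) (deriv (V t) k) = lam t * total_wealth r w t k"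
    if "0 \<le> t" "0 < total_wealth r w t k" for t k
    using that \<gamma> lam_pos[OF that(1)]
    by (simp add: DERIV_imp_deriv[OF V'] inverse_marginal_crra powr_powr)
  define K where "K s t k = total_wealth r w t k * exp (- integral {t..s} (\<lambda>v. lam v - r v))
           - human_wealth r w s" for s t k
  have "capital_flow r w (\<lambda>s x. inverse_marginal (crra \<gamma>) (deriv (V s) x)) K"
    unfolding K_def by (intro capital_flow_proportional r w pv lam inv)
  moreover have "((\<lambda>s. h (s - t) * crra \<gamma> (inverse_marginal (crra \<gamma>) (deriv (V s) (K s t k))))
      has_integral V t k) {t..}" if tk: "0 \<le> t" "0 < total_wealth r w t k" for t k
  proof (rule has_integral_eq[OF _ V[OF tk]])
    fix s assume "s \<in> {t..}"
    moreover have "total_wealth r w s (K s t k)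
        = total_wealth r w t k * exp (- integral {t..s} (\<lambda>v. lam v - r v))"
      by (simp add: K_def total_wealth_def[of r w s])
    ultimately show "h (s - t) * crra \<gamma> (lam s * (total_wealth r w t k * exp (- integral {t..s} (\<lambda>v. lam v - r v))))
        = h (s - t) * crra \<gamma> (inverse_marginal (crra \<gamma>) (deriv (V s) (K s t k)))"
      using tk by (subst inv) auto
  qed
  moreover have "V t differentiable (at k)" "0 < deriv (V t) k"
    if "0 \<le> t" "0 < total_wealth r w t k" for t k
    using V'[OF that] lam_pos[OF that(1)] that
    by (auto simp: DERIV_imp_deriv[OF V'[OF that]] real_differentiable_def)
  ultimately show ?thesis
    unfolding equilibrium_strategy_def using inv by auto
qed

theorem proposition7:
  fixes h r w lam :: "real \<Rightarrow> real" and \<gamma> :: real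
  assumes "discount_function h"
    and "0 < \<gamma>"
    and "\<And>T. r absolutely_integrable_on {0..T}"
    and "\<And>T. w absolutely_integrable_on {0..T}"
    and "\<And>t. 0 \<le> t \<Longrightarrow> (\<lambda>s. exp (- integral {t..s} r) * w s) integrable_on {t..}"
    and "\<And>t. 0 \<le> t \<Longrightarrow> 0 \<le> lam t"
    and "\<And>T. lam absolutely_integrable_on {0..T}"
    and "solves_fixed_point h r \<gamma> lam"
    and "\<gamma> = 1 \<Longrightarrow> log_utility_integrable h r lam"
  defines "\<sigma> \<equiv> \<lambda>t k. lam t * total_wealth r w t k"
  shows "(\<exists>V. equilibrium_strategy h (crra \<gamma>) r w \<sigma> V) \<and>
    (\<gamma> \<noteq> 1 \<longrightarrow> equilibrium_strategy h (crra \<gamma>) r w \<sigma>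
       (\<lambda>t k. lam t powr (- \<gamma>) * (total_wealth r w t k powr (1 - \<gamma>) / (1 - \<gamma>))))"
proof -
  define I where "I t = integral {t..} (fixed_point_integrand h r \<gamma> lam t)" for t
  have I: "(fixed_point_integrand h r \<gamma> lam t has_integral I t) {t..}" "0 < I t"
    "lam t = I t powr (- 1 / \<gamma>)" if "0 \<le> t" for t
    using assms(8) that by (auto simp: solves_fixed_point_def I_def integrable_integral)
  have lam_pos: "0 < lam t" if "0 \<le> t" for t
    using I(2)[OF that] by (simp add: I(3)[OF that])
  have lam_I: "lam t powr (- \<gamma>) = I t" if "0 \<le> t" for t
    using I(2)[OF that] assms(2) by (simp add: I(3)[OF that] powr_powr)
  note proportional = equilibrium_strategy_proportional[OF assms(2-5,7) lam_pos]
  show ?thesis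
  proof (cases "\<gamma> = 1")
    case True
    \<comment> \<open>The part of the value function that does not depend on capital: the utility from total wealth 1.\<close>
    define C where "C t = integral {t..} (\<lambda>s. h (s - t) * ln (lam s * exp (- integral {t..s} (\<lambda>v. lam v - r v))))"
      for t
    have "equilibrium_strategy h (crra \<gamma>) r w (\<lambda>t k. lam t * total_wealth r w t k)
        (\<lambda>t k. C t + ln (total_wealth r w t k) * I t)"
    proof (rule proportional)
      fix t k assume tk: "0 \<le> t" "0 < total_wealth r w t k"
      have "((\<lambda>k. C t + ln (total_wealth r w t k) * I t) has_real_derivative I t / total_wealth r w t k) (at k)"
        using tk by (auto simp: total_wealth_def intro!: derivative_eq_intros)
      also have "I t / total_wealth r w t k = (lam t * total_wealth r w t k) powr (- \<gamma>)"
        using tk lam_pos[OF tk(1)] True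
        by (simp add: powr_mult lam_I[OF tk(1), symmetric] powr_minus_divide)
      finally show "((\<lambda>k. C t + ln (total_wealth r w t k) * I t) has_real_derivative
          (lam t * total_wealth r w t k) powr (- \<gamma>)) (at k)" .
      have "((\<lambda>s. h (s - t) * ln (lam s * exp (- integral {t..s} (\<lambda>v. lam v - r v)))) has_integral C t) {t..}"
        using assms(9)[OF True] tk by (auto simp: log_utility_integrable_def C_def integrable_integral)
      from has_integral_add[OF this has_integral_mult_right[OF I(1)[OF tk(1)]]]
      show "((\<lambda>s. h (s - t) * crra \<gamma> (lam s * (total_wealth r w t k * exp (- integral {t..s} (\<lambda>v. lam v - r v)))))
         has_integral C t + ln (total_wealth r w t k) * I t) {t..}"
      proof (rule has_integral_eq[rotated])
        fix s assume "s \<in> {t..}"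
        then have "0 < lam s"
          using tk lam_pos by simp
        then show "h (s - t) * ln (lam s * exp (- integral {t..s} (\<lambda>v. lam v - r v)))
            + ln (total_wealth r w t k) * fixed_point_integrand h r \<gamma> lam t s
          = h (s - t) * crra \<gamma> (lam s * (total_wealth r w t k * exp (- integral {t..s} (\<lambda>v. lam v - r v))))"
          using tk True by (simp add: crra_def fixed_point_integrand_def ln_mult algebra_simps)
      qed
    qed
    then show ?thesis
      unfolding \<sigma>_def using True by blast
  next
    case False
    have "equilibrium_strategy h (crra \<gamma>) r w (\<lambda>t k. lam t * total_wealth r w t k)
        (\<lambda>t k. lam t powr (- \<gamma>) * (total_wealth r w t k powr (1 - \<gamma>) / (1 - \<gamma>)))"
    proof (rule proportional)
      fix t k assume tk: "0 \<le> t" "0 < total_wealth r w t k"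
      show "((\<lambda>k. lam t powr (- \<gamma>) * (total_wealth r w t k powr (1 - \<gamma>) / (1 - \<gamma>))) has_real_derivative
          (lam t * total_wealth r w t k) powr (- \<gamma>)) (at k)"
        using tk lam_pos[OF tk(1)] False
        by (auto simp: total_wealth_def powr_mult intro!: derivative_eq_intros)
      define c where "c = total_wealth r w t k powr (1 - \<gamma>) / (1 - \<gamma>)"
      have "((\<lambda>s. c * fixed_point_integrand h r \<gamma> lam t s) has_integral c * I t) {t..}"
        by (rule has_integral_mult_right[OF I(1)[OF tk(1)]])
      then show "((\<lambda>s. h (s - t) * crra \<gamma> (lam s * (total_wealth r w t k * exp (- integral {t..s} (\<lambda>v. lam v - r v)))))
         has_integral lam t powr (- \<gamma>) * (total_wealth r w t k powr (1 - \<gamma>) / (1 - \<gamma>))) {t..}"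
        unfolding lam_I[OF tk(1)] c_def[symmetric] mult.commute[of "I t"]
      proof (rule has_integral_eq[rotated])
        fix s assume "s \<in> {t..}"
        then have "0 < lam s"
          using tk lam_pos by simp
        then show "c * fixed_point_integrand h r \<gamma> lam t s
          = h (s - t) * crra \<gamma> (lam s * (total_wealth r w t k * exp (- integral {t..s} (\<lambda>v. lam v - r v))))"
          using tk False
          by (simp add: crra_def c_def fixed_point_integrand_def powr_mult exp_powr_real algebra_simps)
      qed
    qed
    then show ?thesis
      unfolding \<sigma>_def using False by blast
  qed
qed

end
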